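(* Let $A$ be a Mackey complete continuous inverse algebra over $\mathbb{K}\in\{\mathbb{R},\mathbb{C}\}$, let $G$ be a (possibly infinite-dimensional) Lie group acting smoothly on $A$ by automorphisms via $\mu_A\colon G\to\mathrm{Aut}(A)$, and let $E$ be a finitely generated projective right $A$-module. Then the subgroup $$G_E:=\{g\in G: E^{g}\cong E\}=\mu_A^{-1}(\mathrm{Aut}(A)_E)$$ of $G$ is open. In particular, $\mu_A(G)\subseteq \mathrm{Aut}(A)_E$ if $G$ is connected.
   Context: A continuous inverse algebra (CIA) is a unital associative locally convex topological algebra over $\mathbb{K}$ whose unit group is open and whose inversion is continuous. A locally convex space is Mackey complete if every smooth curve defined on $[0,1]$ has a (weak) integral in it. Lie groups are modeled on locally convex spaces. $\mathrm{Aut}(A)$ is the group of topological algebra automorphisms; the action is smooth if $G\times A\to A$, $(g,a)\mapsto\mu_A(g)(a)$, is smooth. A finitely generated projective right $A$-module is isomorphic to $pA^n$ for an idempotent $p\in M_n(A)$ and is topologized as the subspace $pA^n\subseteq A^n$. For $\psi\in\mathrm{Aut}(A)$ the twisted module $E^\psi$ is the vector space $E$ with the right $A$-module structure $s*_\psi a:=s.\psi(a)$, and $E^g:=E^{\mu_A(g)}$. $\mathrm{Aut}(A)_E=\{\psi\in\mathrm{Aut}(A):E^\psi\cong E \text{ as right } A\text{-modules}\}$; equivalently, the set of $\psi$ for which there is a continuous linear automorphism $\phi$ of $E$ (with continuous inverse) with $\phi(s.a)=\phi(s).\psi(a)$ for all $s\in E,a\in A$. *)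

theory Defs
  imports "HOL-Analysis.Analysis" "HOL-Algebra.Group"
begin

section \<open>The ground field\<close>

text \<open>The real normed fields that are, up to isomorphism, \<open>\<real>\<close> or \<open>\<complex>\<close>.\<close>

class real_or_complex = real_normed_field +
  assumes real_or_complex:
    "(\<forall>z. \<exists>x. z = x *\<^sub>R 1) \<or> (\<exists>i. i * i = - 1 \<and> (\<forall>z. \<exists>x y. z = x *\<^sub>R 1 + y *\<^sub>R i))"

instance real :: real_or_complex
  by standard auto

instance complex :: real_or_complex
proof
  have "z = Re z *\<^sub>R 1 + Im z *\<^sub>R \<i>" for z :: complex
    by (simp add: complex_eq_iff)
  then have "\<i> * \<i> = - 1 \<and> (\<forall>z. \<exists>x y. z = x *\<^sub>R 1 + y *\<^sub>R \<i>)"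
    by (metis i_squared)
  then show "(\<forall>z :: complex. \<exists>x. z = x *\<^sub>R 1) \<or>
      (\<exists>i :: complex. i * i = - 1 \<and> (\<forall>z. \<exists>x y. z = x *\<^sub>R 1 + y *\<^sub>R i))"
    by blast
qed


section \<open>Locally convex spaces and smooth maps\<close>

text \<open>Locally convex spaces are Hausdorff, and the class records the underlying real structure.
  For \<open>\<complex>\<close>, the additional scalar multiplication is an explicit parameter (see below); local
  convexity does not depend on it. The last axiom is the existence of a base of convex open
  neighbourhoods of \<open>0\<close>; \<^const>\<open>convex\<close> itself cannot be used in the class specification.\<close>

class locally_convex_space = real_vector + t2_space + topological_ab_group_add +
  assumes tendsto_scaleR_Pair: "LIM p (nhds r \<times>\<^sub>F nhds x). fst p *\<^sub>R snd p :> nhds (r *\<^sub>R x)"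
    and convex_nhds_base_raw:
      "open U \<Longrightarrow> 0 \<in> U \<Longrightarrow> \<exists>V. open V \<and> 0 \<in> V \<and> V \<subseteq> U \<and>
        (\<forall>x\<in>V. \<forall>y\<in>V. \<forall>u\<ge>0. \<forall>v\<ge>0. u + v = 1 \<longrightarrow> u *\<^sub>R x + v *\<^sub>R y \<in> V)"

lemma convex_nhds_base:
  fixes U :: "'a::locally_convex_space set"
  assumes "open U" "0 \<in> U"
  shows "\<exists>V. open V \<and> 0 \<in> V \<and> V \<subseteq> U \<and> convex V"
  using convex_nhds_base_raw [OF assms] by (simp add: convex_def)

instance real_normed_vector \<subseteq> locally_convex_space
proof
  fix r :: real and x :: 'a
  show "LIM p (nhds r \<times>\<^sub>F nhds x). fst p *\<^sub>R snd p :> nhds (r *\<^sub>R x)"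
    unfolding nhds_prod [symmetric]
    by (intro tendsto_scaleR tendsto_fst [of _ "(r, x)", simplified]
        tendsto_snd [of _ "(r, x)", simplified] filterlim_ident)
next
  fix U :: "'a set"
  assume "open U" "0 \<in> U"
  then obtain e where "e > 0" "ball 0 e \<subseteq> U"
    by (auto simp: open_contains_ball)
  then have "\<exists>V. open V \<and> 0 \<in> V \<and> V \<subseteq> U \<and> convex V"
    by (intro exI [of _ "ball 0 e"]) auto
  then show "\<exists>V. open V \<and> 0 \<in> V \<and> V \<subseteq> U \<and>
      (\<forall>x\<in>V. \<forall>y\<in>V. \<forall>u\<ge>0. \<forall>v\<ge>0. u + v = 1 \<longrightarrow> u *\<^sub>R x + v *\<^sub>R y \<in> V)"
    by (simp add: convex_def)
qed

instance prod :: (topological_monoid_add, topological_monoid_add) topological_monoid_add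
proof
  fix a b :: "'a \<times> 'b"
  have 1: "((\<lambda>p. fst (fst p) + fst (snd p)) \<longlongrightarrow> fst a + fst b) (nhds (a, b))"
    by (intro tendsto_add tendsto_fst [of _ a] tendsto_fst [of _ b]
        tendsto_fst [of _ "(a, b)", simplified] tendsto_snd [of _ "(a, b)", simplified]
        filterlim_ident)
  have 2: "((\<lambda>p. snd (fst p) + snd (snd p)) \<longlongrightarrow> snd a + snd b) (nhds (a, b))"
    by (intro tendsto_add tendsto_snd [of _ a] tendsto_snd [of _ b]
        tendsto_fst [of _ "(a, b)", simplified] tendsto_snd [of _ "(a, b)", simplified]
        filterlim_ident)
  show "LIM x (nhds a \<times>\<^sub>F nhds b). fst x + snd x :> nhds (a + b)"
    using tendsto_Pair [OF 1 2] unfolding nhds_prod [symmetric] plus_prod_def .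
qed

instance prod :: (topological_group_add, topological_group_add) topological_group_add
proof
  fix a :: "'a \<times> 'b"
  have "((\<lambda>p. (- fst p, - snd p)) \<longlongrightarrow> (- fst a, - snd a)) (nhds a)"
    by (intro tendsto_Pair tendsto_minus tendsto_fst tendsto_snd filterlim_ident)
  moreover have "uminus = (\<lambda>p :: 'a \<times> 'b. (- fst p, - snd p))"
    by (simp add: fun_eq_iff uminus_prod_def)
  ultimately show "(uminus \<longlongrightarrow> - a) (nhds a)"
    by (simp add: uminus_prod_def)
qed

instance prod :: (topological_ab_group_add, topological_ab_group_add) topological_ab_group_add ..

instance prod :: (locally_convex_space, locally_convex_space) locally_convex_space
proof
  fix r :: real and x :: "'a \<times> 'b"
  have scl: "((\<lambda>p. f p *\<^sub>R g p) \<longlongrightarrow> r *\<^sub>R y) F"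
    if "(f \<longlongrightarrow> r) F" "(g \<longlongrightarrow> y) F"
    for f and g :: "real \<times> 'a \<times> 'b \<Rightarrow> 'c :: locally_convex_space" and y F
    using filterlim_compose [OF tendsto_scaleR_Pair, of "\<lambda>p. (f p, g p)" r y F] that
    by (simp add: nhds_prod [symmetric] tendsto_Pair)
  have p1: "(fst \<longlongrightarrow> r) (nhds (r, x))"
    by (intro tendsto_fst [of _ "(r, x)", simplified] filterlim_ident)
  have p2: "(snd \<longlongrightarrow> x) (nhds (r, x))"
    by (intro tendsto_snd [of _ "(r, x)", simplified] filterlim_ident)
  have "((\<lambda>p. (fst p *\<^sub>R fst (snd p), fst p *\<^sub>R snd (snd p)))
          \<longlongrightarrow> (r *\<^sub>R fst x, r *\<^sub>R snd x)) (nhds (r, x))"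
    by (intro tendsto_Pair scl p1 tendsto_fst p2 tendsto_snd)
  then show "LIM p (nhds r \<times>\<^sub>F nhds x). fst p *\<^sub>R snd p :> nhds (r *\<^sub>R x)"
    unfolding nhds_prod [symmetric] scaleR_prod_def .
next
  fix U :: "('a \<times> 'b) set"
  assume "open U" "0 \<in> U"
  then obtain A B where AB: "open A" "open B" "0 \<in> A" "0 \<in> B" "A \<times> B \<subseteq> U"
    by (elim open_prod_elim) (auto simp: zero_prod_def)
  obtain V where V: "open V" "convex V" "0 \<in> V" "V \<subseteq> A"
    using convex_nhds_base [OF AB(1,3)] by blast
  obtain W where W: "open W" "convex W" "0 \<in> W" "W \<subseteq> B"
    using convex_nhds_base [OF AB(2,4)] by blast
  have "open (V \<times> W)" "convex (V \<times> W)"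
    using V W by (simp_all add: open_Times convex_Times)
  moreover have "0 \<in> V \<times> W" "V \<times> W \<subseteq> U"
    using V(3,4) W(3,4) AB(5) by (auto simp: zero_prod_def)
  ultimately have "\<exists>V. open V \<and> 0 \<in> V \<and> V \<subseteq> U \<and> convex V"
    by (intro exI [of _ "V \<times> W"] conjI)
  then show "\<exists>V. open V \<and> 0 \<in> V \<and> V \<subseteq> U \<and>
      (\<forall>x\<in>V. \<forall>y\<in>V. \<forall>u\<ge>0. \<forall>v\<ge>0. u + v = 1 \<longrightarrow> u *\<^sub>R x + v *\<^sub>R y \<in> V)"
    by (simp add: convex_def)
qed

text \<open>Smoothness (over \<open>\<real>\<close>) in the sense of Michal--Bastiani, for \<open>U\<close> open: all iterated directional
  derivatives \<open>d\<^sup>j f(x)(h\<^sub>0, \<dots>, h\<^sub>j\<^sub>-\<^sub>1) = (\<partial>\<^bsub>h\<^sub>j\<^sub>-\<^sub>1\<^esub> \<dots> \<partial>\<^bsub>h\<^sub>0\<^esub> f)(x)\<close> exist and are jointly continuous on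
  \<open>U \<times> E\<^sup>j\<close>. The directions are packed in a sequence \<open>h\<close>, of which \<open>D j x h\<close> depends on the first \<open>j\<close>
  members only (for \<open>x \<in> U\<close>; limits are unique), so that continuity for the product topology on
  sequences is continuity on \<open>U \<times> E\<^sup>j\<close>.\<close>

definition smooth_on ::
  "'e::locally_convex_space set \<Rightarrow> ('e \<Rightarrow> 'f::locally_convex_space) \<Rightarrow> bool" where
  "smooth_on U f \<longleftrightarrow>
    (\<exists>D :: nat \<Rightarrow> 'e \<Rightarrow> (nat \<Rightarrow> 'e) \<Rightarrow> 'f.
      (\<forall>x\<in>U. \<forall>h. D 0 x h = f x) \<and>
      (\<forall>j. \<forall>x\<in>U. \<forall>h.
        ((\<lambda>t. (1 / t) *\<^sub>R (D j (x + t *\<^sub>R h j) h - D j x h)) \<longlongrightarrow> D (Suc j) x h) (at 0)) \<and>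
      (\<forall>j. continuous_on (U \<times> UNIV) (\<lambda>(x, h). D j x h)))"

text \<open>Smooth curves on \<open>[0,1]\<close>, with one-sided derivatives at the end points; continuity of the
  derivatives \<open>D n\<close> follows from their differentiability.\<close>

definition smooth_curve :: "(real \<Rightarrow> 'e::locally_convex_space) \<Rightarrow> bool" where
  "smooth_curve \<gamma> \<longleftrightarrow>
    (\<exists>D :: nat \<Rightarrow> real \<Rightarrow> 'e.
      (\<forall>t\<in>{0..1}. D 0 t = \<gamma> t) \<and>
      (\<forall>n. \<forall>t\<in>{0..1}.
        ((\<lambda>s. (1 / (s - t)) *\<^sub>R (D n s - D n t)) \<longlongrightarrow> D (Suc n) t) (at t within {0..1})))"

locale locally_convex_over = vector_space sc
  for sc :: "'k::real_or_complex \<Rightarrow> 'e::locally_convex_space \<Rightarrow> 'e" +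
  assumes scale_of_real: "sc (of_real r) x = r *\<^sub>R x"
    and continuous_scale: "continuous_on UNIV (\<lambda>(c, x). sc c x)"

definition mackey_complete ::
  "('k::real_or_complex \<Rightarrow> 'e::locally_convex_space \<Rightarrow> 'e) \<Rightarrow> bool" where
  "mackey_complete sc \<longleftrightarrow>
    (\<forall>\<gamma>. smooth_curve \<gamma> \<longrightarrow>
      (\<exists>I. \<forall>l :: 'e \<Rightarrow> 'k. Vector_Spaces.linear sc (*) l \<and> continuous_on UNIV l \<longrightarrow>
        ((\<lambda>t. l (\<gamma> t)) has_integral l I) {0..1}))"


section \<open>Continuous inverse algebras\<close>

definition alg_units :: "'a::monoid_mult set" where
  "alg_units = {x. \<exists>y. x * y = 1 \<and> y * x = 1}"

definition alg_inverse :: "'a::monoid_mult \<Rightarrow> 'a" where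
  "alg_inverse x = (THE y. x * y = 1 \<and> y * x = 1)"

text \<open>The sort used for unital algebras is not \<open>real_algebra_1\<close>, because that class demands \<open>0 \<noteq> 1\<close>
  and so excludes the zero algebra.\<close>

locale continuous_inverse_algebra = locally_convex_over sc
  for sc :: "'k::real_or_complex \<Rightarrow>
    'a::{real_algebra, monoid_mult, locally_convex_space} \<Rightarrow> 'a" +
  assumes scale_mult_left: "sc c x * y = sc c (x * y)"
    and scale_mult_right: "x * sc c y = sc c (x * y)"
    and continuous_mult: "continuous_on UNIV (\<lambda>(x :: 'a, y). x * y)"
    and open_units: "open (alg_units :: 'a set)"
    and continuous_inverse: "continuous_on (alg_units :: 'a set) alg_inverse"

definition algebra_aut ::
  "('k \<Rightarrow> 'a::{ring, monoid_mult, topological_space} \<Rightarrow> 'a) \<Rightarrow> ('a \<Rightarrow> 'a) set" where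
  "algebra_aut sc =
    {\<psi>. (\<exists>\<theta>. homeomorphism UNIV UNIV \<psi> \<theta>) \<and>
        (\<forall>x y. \<psi> (x + y) = \<psi> x + \<psi> y) \<and> (\<forall>c x. \<psi> (sc c x) = sc c (\<psi> x)) \<and>
        (\<forall>x y. \<psi> (x * y) = \<psi> x * \<psi> y) \<and> \<psi> 1 = 1}"

definition algebra_aut_group ::
  "('k \<Rightarrow> 'a::{ring, monoid_mult, topological_space} \<Rightarrow> 'a) \<Rightarrow> ('a \<Rightarrow> 'a) monoid" where
  "algebra_aut_group sc =
    \<lparr>carrier = algebra_aut sc, mult = (\<circ>), one = id\<rparr>"


section \<open>Manifolds and Lie groups\<close>

text \<open>Manifolds, Lie groups and smooth actions are real, also when the algebra is complex; complex
  Lie groups and actions are included by way of their underlying real structures.\<close>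

type_synonym ('p, 'm) chart = "'p set \<times> ('p \<Rightarrow> 'm)"

definition smooth_atlas ::
  "'p topology \<Rightarrow> ('p, 'm::locally_convex_space) chart set \<Rightarrow> bool" where
  "smooth_atlas X \<A> \<longleftrightarrow>
    (\<forall>(U, \<phi>)\<in>\<A>. openin X U \<and> open (\<phi> ` U) \<and>
      homeomorphic_map (subtopology X U) (top_of_set (\<phi> ` U)) \<phi>) \<and>
    (\<Union>(U, \<phi>)\<in>\<A>. U) = topspace X \<and>
    (\<forall>(U, \<phi>)\<in>\<A>. \<forall>(V, \<psi>)\<in>\<A>. smooth_on (\<phi> ` (U \<inter> V)) (\<psi> \<circ> inv_into U \<phi>))"

definition smooth_map ::
  "'p topology \<Rightarrow> ('p, 'm::locally_convex_space) chart set \<Rightarrow>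
   'q topology \<Rightarrow> ('q, 'n::locally_convex_space) chart set \<Rightarrow> ('p \<Rightarrow> 'q) \<Rightarrow> bool" where
  "smooth_map X \<A> Y \<B> f \<longleftrightarrow>
    continuous_map X Y f \<and>
    (\<forall>(U, \<phi>)\<in>\<A>. \<forall>(V, \<psi>)\<in>\<B>.
      smooth_on (\<phi> ` {x \<in> U. f x \<in> V}) (\<psi> \<circ> f \<circ> inv_into U \<phi>))"

definition prod_atlas ::
  "('p, 'm) chart set \<Rightarrow> ('q, 'n) chart set \<Rightarrow> ('p \<times> 'q, 'm \<times> 'n) chart set" where
  "prod_atlas \<A> \<B> = {(U \<times> V, map_prod \<phi> \<psi>) | U \<phi> V \<psi>. (U, \<phi>) \<in> \<A> \<and> (V, \<psi>) \<in> \<B>}"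

definition vector_atlas :: "('e, 'e) chart set" where
  "vector_atlas = {(UNIV, id)}"

locale lie_group = group G for G (structure) +
  fixes T :: "'g topology" and \<A> :: "('g, 'm::locally_convex_space) chart set"
  assumes topspace_eq: "topspace T = carrier G"
    and hausdorff: "Hausdorff_space T"
    and atlas: "smooth_atlas T \<A>"
    and smooth_mult:
      "smooth_map (prod_topology T T) (prod_atlas \<A> \<A>) T \<A> (\<lambda>(x, y). x \<otimes> y)"
    and smooth_inv: "smooth_map T \<A> T \<A> (\<lambda>x. inv x)"

locale smooth_algebra_action =
  continuous_inverse_algebra sc + lie_group G T \<A>
  for sc :: "'k::real_or_complex \<Rightarrow>
      'a::{real_algebra, monoid_mult, locally_convex_space} \<Rightarrow> 'a"
    and G :: "('g, 'z) monoid_scheme" (structure)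
    and T and \<A> :: "('g, 'm::locally_convex_space) chart set" +
  fixes \<mu> :: "'g \<Rightarrow> 'a \<Rightarrow> 'a"
  assumes action_hom: "\<mu> \<in> hom G (algebra_aut_group sc)"
    and action_smooth:
      "smooth_map (prod_topology T euclidean) (prod_atlas \<A> vector_atlas) euclidean vector_atlas
        (\<lambda>(g, a). \<mu> g a)"


section \<open>Right modules\<close>

text \<open>For a unital algebra over \<open>k\<close>, a right module is a vector space over \<open>k\<close> by way of
  \<open>s . (c 1)\<close>, and module homomorphisms are linear over \<open>k\<close>. Hence only the ring structure of the
  algebra occurs here.\<close>

locale right_module =
  fixes act :: "'e::ab_group_add \<Rightarrow> 'a::{ring, monoid_mult} \<Rightarrow> 'e"
  assumes act_add_left: "act (s + t) a = act s a + act t a"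
    and act_add_right: "act s (a + b) = act s a + act s b"
    and act_mult: "act s (a * b) = act (act s a) b"
    and act_one: "act s 1 = s"

definition rmod_isomorphic ::
  "('e::ab_group_add \<Rightarrow> 'a \<Rightarrow> 'e) \<Rightarrow> ('f::ab_group_add \<Rightarrow> 'a \<Rightarrow> 'f) \<Rightarrow> bool" where
  "rmod_isomorphic act act' \<longleftrightarrow>
    (\<exists>\<phi>. bij \<phi> \<and> (\<forall>s t. \<phi> (s + t) = \<phi> s + \<phi> t) \<and> (\<forall>s a. \<phi> (act s a) = act' (\<phi> s) a))"

definition twist :: "('e \<Rightarrow> 'a \<Rightarrow> 'e) \<Rightarrow> ('a \<Rightarrow> 'a) \<Rightarrow> 'e \<Rightarrow> 'a \<Rightarrow> 'e" where
  "twist act \<psi> = (\<lambda>s a. act s (\<psi> a))"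

text \<open>Elements of \<open>A\<^sup>n\<close> are sequences vanishing from \<open>n\<close> on, and of an \<open>n \<times> n\<close> matrix only the
  entries with indices below \<open>n\<close> are used. Finitely generated projective modules are those
  isomorphic to \<open>p A\<^sup>n\<close> for an idempotent matrix \<open>p\<close>.\<close>

definition idempotent_matrix :: "nat \<Rightarrow> (nat \<Rightarrow> nat \<Rightarrow> 'a::ring) \<Rightarrow> bool" where
  "idempotent_matrix n p \<longleftrightarrow> (\<forall>i<n. \<forall>k<n. (\<Sum>j<n. p i j * p j k) = p i k)"

definition free_module :: "nat \<Rightarrow> (nat \<Rightarrow> 'a::ring) set" where
  "free_module n = {x. \<forall>i\<ge>n. x i = 0}"

definition matrix_image :: "nat \<Rightarrow> (nat \<Rightarrow> nat \<Rightarrow> 'a::ring) \<Rightarrow> (nat \<Rightarrow> 'a) set" where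
  "matrix_image n p = (\<lambda>x i. if i < n then \<Sum>j<n. p i j * x j else 0) ` free_module n"

definition fg_projective :: "('e::ab_group_add \<Rightarrow> 'a::{ring, monoid_mult} \<Rightarrow> 'e) \<Rightarrow> bool" where
  "fg_projective act \<longleftrightarrow>
    (\<exists>n p \<phi>. idempotent_matrix n p \<and> bij_betw \<phi> UNIV (matrix_image n p) \<and>
      (\<forall>s t. \<phi> (s + t) = (\<lambda>i. \<phi> s i + \<phi> t i)) \<and> (\<forall>s a. \<phi> (act s a) = (\<lambda>i. \<phi> s i * a)))"

definition Aut_module ::
  "('k \<Rightarrow> 'a::{ring, monoid_mult, topological_space} \<Rightarrow> 'a) \<Rightarrow> ('e::ab_group_add \<Rightarrow> 'a \<Rightarrow> 'e)
    \<Rightarrow> ('a \<Rightarrow> 'a) set" where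
  "Aut_module sc act = {\<psi> \<in> algebra_aut sc. rmod_isomorphic (twist act \<psi>) act}"

definition module_stabilizer ::
  "('g, 'z) monoid_scheme \<Rightarrow> ('g \<Rightarrow> 'a \<Rightarrow> 'a) \<Rightarrow> ('e::ab_group_add \<Rightarrow> 'a \<Rightarrow> 'e) \<Rightarrow> 'g set" where
  "module_stabilizer G \<mu> act = {g \<in> carrier G. rmod_isomorphic (twist act (\<mu> g)) act}"

end

theory Submission
  imports Defs
begin

text \<open>Write \<open>E \<cong> p A\<^sup>n\<close> with an idempotent matrix \<open>p\<close>. For an automorphism \<open>\<psi>\<close>, applying \<open>\<psi>\<close> entrywise
  maps \<open>p A\<^sup>n\<close> bijectively onto \<open>\<psi>(p) A\<^sup>n\<close> and is semilinear along \<open>\<psi>\<close>. So it suffices for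
  \<open>E\<^sup>\<psi> \<cong> E\<close> that the left multiplication by \<open>p\<close> is a bijection from \<open>\<psi>(p) A\<^sup>n\<close> onto \<open>p A\<^sup>n\<close>; it is
  linear over \<open>A\<close>, and the composition \<open>x \<mapsto> p \<psi>(x)\<close> of the two maps then induces the inverse of an
  isomorphism \<open>E\<^sup>\<psi> \<rightarrow> E\<close> (\<open>rmod_isomorphic_twist\<close>).

  Two idempotents \<open>p\<close> and \<open>q\<close> that are close to each other satisfy this condition, because the
  matrix \<open>z = p q + (1 - p) (1 - q)\<close> intertwines them, \<open>p z = p q = z q\<close>, and is close to
  \<open>p p + (1 - p) (1 - p) = 1\<close> (\<open>matrix_image_bij_betw\<close>). Here one uses that a matrix close to \<open>1\<close>
  acts bijectively on \<open>A\<^sup>n\<close>. This holds by Gaussian elimination: the pivot is close to \<open>1\<close>, hence a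
  unit with inverse close to \<open>1\<close>, and the Schur complement is again a matrix close to \<open>1\<close>
  (\<open>eventually_matrix_regular\<close>).

  The action is continuous in \<open>g\<close>, so for fixed \<open>h\<close> the matrix \<open>\<mu> (h\<^sup>-\<^sup>1 g) (p)\<close> tends to \<open>p\<close> as \<open>g\<close>
  tends to \<open>h\<close>. Hence \<open>h\<^sup>-\<^sup>1 g\<close> lies in the subgroup \<open>G\<^sub>E\<close> for all \<open>g\<close> near \<open>h\<close>, that is, membership in
  \<open>G\<^sub>E\<close> is locally constant. So \<open>G\<^sub>E\<close> is open and closed, and it is all of \<open>G\<close> if \<open>G\<close> is
  connected.\<close>

section \<open>Matrices close to the identity\<close>

context continuous_inverse_algebra
begin

lemma tendsto_mult_algebra:
  assumes "(f \<longlongrightarrow> a) F" "(g \<longlongrightarrow> b) F"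
  shows "((\<lambda>s. f s * g s :: 'a) \<longlongrightarrow> a * b) F"
proof -
  have "isCont (\<lambda>(x :: 'a, y). x * y) (a, b)"
    using continuous_mult by (simp add: continuous_on_eq_continuous_at)
  from isCont_tendsto_compose [OF this tendsto_Pair [OF assms]] show ?thesis
    by simp
qed

lemma alg_inverse_units:
  assumes "(x :: 'a) \<in> alg_units"
  shows "x * alg_inverse x = 1" "alg_inverse x * x = 1"
proof -
  obtain y where y: "x * y = 1" "y * x = 1"
    using assms by (auto simp: alg_units_def)
  have "alg_inverse x = y"
    unfolding alg_inverse_def
  proof (rule the_equality)
    fix y' assume y': "x * y' = 1 \<and> y' * x = 1"
    have "y' = (y * x) * y'"
      by (simp add: y)
    also have "\<dots> = y * (x * y')"
      by (rule mult.assoc)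
    finally show "y' = y"
      by (simp add: y')
  qed (use y in simp)
  with y show "x * alg_inverse x = 1" "alg_inverse x * x = 1"
    by simp_all
qed

lemma one_in_units: "(1 :: 'a) \<in> alg_units"
  by (auto simp: alg_units_def)

lemma alg_inverse_one: "alg_inverse (1 :: 'a) = 1"
  using alg_inverse_units(1) [OF one_in_units] by simp

lemma tendsto_alg_inverse_one:
  assumes "(f \<longlongrightarrow> (1 :: 'a)) F"
  shows "((\<lambda>s. alg_inverse (f s)) \<longlongrightarrow> 1) F"
proof -
  have "isCont alg_inverse (1 :: 'a)"
    using continuous_inverse one_in_units open_units
    by (simp add: continuous_on_eq_continuous_at)
  from isCont_tendsto_compose [OF this assms] show ?thesis
    by (simp add: alg_inverse_one)
qed

text \<open>Invertibility of matrices close to \<open>1\<close>, in the form of unique solvability of linear systems,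
  which avoids the construction of the inverse matrix. Convergence along a filter takes the place of
  neighbourhoods in the space of matrices: the induction hypothesis then applies to the Schur
  complement of the last diagonal entry as soon as its entries have the right limits.\<close>

lemma eventually_matrix_regular:
  fixes z :: "'s \<Rightarrow> nat \<Rightarrow> nat \<Rightarrow> 'a"
  assumes "\<And>i j. i < n \<Longrightarrow> j < n \<Longrightarrow> ((\<lambda>s. z s i j) \<longlongrightarrow> (if i = j then 1 else 0)) F"
  shows "\<forall>\<^sub>F s in F. (\<forall>x. (\<forall>i<n. (\<Sum>j<n. z s i j * x j) = 0) \<longrightarrow> (\<forall>i<n. x i = 0)) \<and>
    (\<forall>y. \<exists>x. \<forall>i<n. (\<Sum>j<n. z s i j * x j) = y i)"
  using assms
proof (induction n arbitrary: z)
  case 0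
  show ?case by simp
next
  case (Suc n)
  let ?e = "\<lambda>s. alg_inverse (z s n n)"
  \<comment> \<open>The Schur complement: what remains of row \<open>i\<close> after elimination of the variable \<open>x n\<close>.\<close>
  define w where "w s i j = z s i j - z s i n * (?e s * z s n j)" for s i j
  have pivot: "((\<lambda>s. z s n n) \<longlongrightarrow> 1) F"
    using Suc.prems [of n n] by simp
  have "((\<lambda>s. w s i j) \<longlongrightarrow> (if i = j then 1 else 0)) F" if "i < n" "j < n" for i j
  proof -
    have "((\<lambda>s. z s i n) \<longlongrightarrow> 0) F" "((\<lambda>s. z s n j) \<longlongrightarrow> 0) F"
      using Suc.prems [of i n] Suc.prems [of n j] that by simp_all
    then have "((\<lambda>s. z s i n * (?e s * z s n j)) \<longlongrightarrow> 0 * (1 * 0)) F"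
      by (intro tendsto_mult_algebra tendsto_alg_inverse_one pivot)
    from tendsto_diff [OF Suc.prems [of i j] this] that show ?thesis
      by (simp add: w_def)
  qed
  from Suc.IH [OF this]
  have IH: "\<forall>\<^sub>F s in F. (\<forall>x. (\<forall>i<n. (\<Sum>j<n. w s i j * x j) = 0) \<longrightarrow> (\<forall>i<n. x i = 0)) \<and>
    (\<forall>y. \<exists>x. \<forall>i<n. (\<Sum>j<n. w s i j * x j) = y i)" .
  have "\<forall>\<^sub>F s in F. z s n n \<in> alg_units"
    using topological_tendstoD [OF pivot open_units one_in_units] .
  with IH show ?case
  proof eventually_elim
    case (elim s)
    note unit = alg_inverse_units [OF elim(2)]
    have w_sum: "(\<Sum>j<n. w s i j * x j) =
        (\<Sum>j<n. z s i j * x j) - z s i n * (?e s * (\<Sum>j<n. z s n j * x j))" for x i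
      by (simp add: w_def left_diff_distrib sum_subtractf sum_distrib_left mult.assoc)
    show ?case
    proof (intro conjI allI impI)
      fix x i
      assume *: "\<forall>i<Suc n. (\<Sum>j<Suc n. z s i j * x j) = 0" and "i < Suc n"
      have "?e s * ((\<Sum>j<n. z s n j * x j) + z s n n * x n) = 0"
        using * by simp
      then have last: "?e s * (\<Sum>j<n. z s n j * x j) = - x n"
        by (simp add: distrib_left unit eq_neg_iff_add_eq_0 flip: mult.assoc)
      have "(\<Sum>j<n. w s i j * x j) = 0" if "i < n" for i
        using * that by (simp add: w_sum last)
      then have "\<forall>i<n. x i = 0"
        using elim(1) by blast
      with last \<open>i < Suc n\<close> show "x i = 0"
        by (auto simp: less_Suc_eq)
    next
      fix y
      \<comment> \<open>The elimination of \<open>x n\<close> changes the right-hand side as well; back substitution into row \<open>n\<close>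
        then determines the last component.\<close>
      obtain x where x: "\<And>i. i < n \<Longrightarrow>
          (\<Sum>j<n. w s i j * x j) = y i - z s i n * (?e s * y n)"
        using conjunct2 [OF elim(1), rule_format, of "\<lambda>i. y i - z s i n * (?e s * y n)"] by blast
      define x' where "x' = x(n := ?e s * (y n - (\<Sum>j<n. z s n j * x j)))"
      have "(\<Sum>j<Suc n. z s i j * x' j) = y i" if "i < Suc n" for i
      proof (cases "i = n")
        case True
        then show ?thesis
          by (simp add: x'_def unit flip: mult.assoc)
      next
        case False
        then show ?thesis
          using x [of i] that
          by (simp add: x'_def w_sum right_diff_distrib algebra_simps)
      qed
      then show "\<exists>x. \<forall>i<Suc n. (\<Sum>j<Suc n. z s i j * x j) = y i"
        by blast
    qed
  qed
qed

end


section \<open>Isomorphic images of idempotent matrices\<close>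

text \<open>The zero tail keeps the result inside \<^const>\<open>free_module\<close>; with it, the image of an idempotent
  matrix is the set of its fixed points among all sequences.\<close>

definition matrix_apply :: "nat \<Rightarrow> (nat \<Rightarrow> nat \<Rightarrow> 'a::ring) \<Rightarrow> (nat \<Rightarrow> 'a) \<Rightarrow> nat \<Rightarrow> 'a" where
  "matrix_apply n p x = (\<lambda>i. if i < n then \<Sum>j<n. p i j * x j else 0)"

lemma matrix_apply_apply:
  "matrix_apply n p (matrix_apply n q x) = matrix_apply n (\<lambda>i k. \<Sum>j<n. p i j * q j k) x"
proof
  fix i
  have "(\<Sum>j<n. p i j * (\<Sum>k<n. q j k * x k)) = (\<Sum>k<n. (\<Sum>j<n. p i j * q j k) * x k)"
    unfolding sum_distrib_left sum_distrib_right
    by (subst sum.swap) (simp add: mult.assoc)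
  then show "matrix_apply n p (matrix_apply n q x) i =
      matrix_apply n (\<lambda>i k. \<Sum>j<n. p i j * q j k) x i"
    by (simp add: matrix_apply_def)
qed

lemma matrix_apply_idempotent:
  assumes "idempotent_matrix n p"
  shows "matrix_apply n p (matrix_apply n p x) = matrix_apply n p x"
  unfolding matrix_apply_apply using assms
  by (auto simp: matrix_apply_def idempotent_matrix_def fun_eq_iff)

lemma matrix_image_eq_fixed:
  assumes "idempotent_matrix n p"
  shows "matrix_image n p = {x. matrix_apply n p x = x}"
proof -
  have "matrix_image n p = matrix_apply n p ` free_module n"
    by (simp add: matrix_image_def matrix_apply_def)
  moreover have "x \<in> matrix_apply n p ` free_module n" if x: "matrix_apply n p x = x" for x
  proof (rule image_eqI)
    show "x = matrix_apply n p x"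
      using x by (rule sym)
    have "matrix_apply n p x i = 0" if "i \<ge> n" for i
      using that by (simp add: matrix_apply_def)
    then show "x \<in> free_module n"
      by (simp add: free_module_def x)
  qed
  ultimately show ?thesis
    by (auto simp: matrix_apply_idempotent [OF assms])
qed

text \<open>The matrix \<open>p q + (1 - p) (1 - q)\<close>, multiplied out.\<close>

definition intertwiner ::
  "nat \<Rightarrow> (nat \<Rightarrow> nat \<Rightarrow> 'a::{ring, monoid_mult}) \<Rightarrow> (nat \<Rightarrow> nat \<Rightarrow> 'a) \<Rightarrow> nat \<Rightarrow> nat \<Rightarrow> 'a" where
  "intertwiner n p q i k = (if i = k then 1 else 0) - p i k - q i k +
    ((\<Sum>j<n. p i j * q j k) + (\<Sum>j<n. p i j * q j k))"

lemma matrix_apply_intertwiner: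
  assumes "i < n"
  shows "matrix_apply n (intertwiner n p q) x i =
    x i - matrix_apply n p x i - matrix_apply n q x i +
    (matrix_apply n p (matrix_apply n q x) i + matrix_apply n p (matrix_apply n q x) i)"
proof -
  have "(\<Sum>k<n. (if i = k then 1 else 0) * x k) = (\<Sum>k<n. if i = k then x k else 0)"
    by (intro sum.cong) auto
  also have "\<dots> = x i"
    using assms by simp
  finally show ?thesis
    using assms unfolding matrix_apply_apply
    by (simp add: matrix_apply_def intertwiner_def sum.distrib sum_subtractf
        left_diff_distrib distrib_right)
qed

lemma matrix_apply_add:
  "matrix_apply n p (\<lambda>i. x i + y i) = (\<lambda>i. matrix_apply n p x i + matrix_apply n p y i)"
  by (simp add: matrix_apply_def fun_eq_iff distrib_left sum.distrib)

lemma matrix_apply_diff: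
  "matrix_apply n p (\<lambda>i. x i - y i) = (\<lambda>i. matrix_apply n p x i - matrix_apply n p y i)"
  by (simp add: matrix_apply_def fun_eq_iff right_diff_distrib sum_subtractf)

lemma matrix_apply_right_mult:
  "matrix_apply n p (\<lambda>i. x i * a) = (\<lambda>i. matrix_apply n p x i * a)"
  by (simp add: matrix_apply_def fun_eq_iff sum_distrib_right mult.assoc)

lemma matrix_apply_cong:
  "(\<And>i. i < n \<Longrightarrow> x i = y i) \<Longrightarrow> matrix_apply n p x = matrix_apply n p y"
  by (auto simp: matrix_apply_def fun_eq_iff intro!: sum.cong)

text \<open>On the image of \<open>q\<close>, the multiplication by \<open>p\<close> agrees with that by \<open>z = intertwiner n p q\<close>, because
  \<open>z q = p q\<close>; this gives injectivity. If \<open>y\<close> is in the image of \<open>p\<close> and \<open>z x = y\<close>, then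
  \<open>y = p z x = p (q x)\<close>; this gives surjectivity.\<close>

lemma matrix_image_bij_betw:
  assumes p: "idempotent_matrix n p" and q: "idempotent_matrix n q"
    and inj: "\<And>x. \<forall>i<n. (\<Sum>j<n. intertwiner n p q i j * x j) = 0 \<Longrightarrow> \<forall>i<n. x i = 0"
    and surj: "\<And>y. \<exists>x. \<forall>i<n. (\<Sum>j<n. intertwiner n p q i j * x j) = y i"
  shows "bij_betw (matrix_apply n p) (matrix_image n q) (matrix_image n p)"
proof -
  let ?p = "matrix_apply n p" and ?q = "matrix_apply n q"
    and ?z = "matrix_apply n (intertwiner n p q)"
  note p' = matrix_apply_idempotent [OF p] and q' = matrix_apply_idempotent [OF q]
  have zq: "?z (?q x) i = ?p (?q x) i" if "i < n" for x i
    by (simp add: matrix_apply_intertwiner [OF that] q')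
  have pz: "?p (?z x) = ?p (?q x)" for x
  proof -
    have "?p (?z x) = ?p (\<lambda>i. x i - ?p x i - ?q x i + (?p (?q x) i + ?p (?q x) i))"
      by (rule matrix_apply_cong) (rule matrix_apply_intertwiner)
    also have "\<dots> = ?p (?q x)"
      by (simp add: matrix_apply_add matrix_apply_diff p')
    finally show ?thesis .
  qed
  show ?thesis
    unfolding matrix_image_eq_fixed [OF p] matrix_image_eq_fixed [OF q]
  proof (rule bij_betw_imageI)
    show "inj_on ?p {x. ?q x = x}"
    proof (rule inj_onI)
      fix x y assume xy: "x \<in> {x. ?q x = x}" "y \<in> {x. ?q x = x}" "?p x = ?p y"
      let ?d = "\<lambda>i. x i - y i"
      have qd: "?q ?d = ?d"
        using xy by (simp add: matrix_apply_diff)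
      have "?z ?d i = 0" if "i < n" for i
        using zq [OF that, of ?d] xy(3) unfolding qd by (simp add: matrix_apply_diff)
      then have "?d i = 0" if "i < n" for i
        using inj [of ?d] that by (simp add: matrix_apply_def)
      then have "?q x = ?q y"
        by (intro matrix_apply_cong) simp
      with xy show "x = y" by simp
    qed
    show "?p ` {x. ?q x = x} = {x. ?p x = x}"
    proof (intro equalityI subsetI)
      fix y assume y: "y \<in> {x. ?p x = x}"
      obtain x where x: "\<forall>i<n. (\<Sum>j<n. intertwiner n p q i j * x j) = y i"
        using surj by blast
      then have "?p (?z x) = ?p y"
        by (intro matrix_apply_cong) (simp add: matrix_apply_def)
      with y have "y = ?p (?q x)"
        by (simp add: pz)
      moreover have "?q x \<in> {x. ?q x = x}"
        by (simp add: q')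
      ultimately show "y \<in> ?p ` {x. ?q x = x}"
        by (rule image_eqI)
    qed (auto simp: p')
  qed
qed

lemma (in continuous_inverse_algebra) eventually_matrix_image_bij_betw:
  fixes p :: "nat \<Rightarrow> nat \<Rightarrow> 'a"
  assumes p: "idempotent_matrix n p" and q: "\<And>s. idempotent_matrix n (q s)"
    and lim: "\<And>i j. ((\<lambda>s. q s i j) \<longlongrightarrow> p i j) F"
  shows "\<forall>\<^sub>F s in F. bij_betw (matrix_apply n p) (matrix_image n (q s)) (matrix_image n p)"
proof -
  have "((\<lambda>s. intertwiner n p (q s) i k) \<longlongrightarrow> (if i = k then 1 else 0)) F"
    if "i < n" "k < n" for i k
  proof -
    have "((\<lambda>s. intertwiner n p (q s) i k) \<longlongrightarrow> intertwiner n p p i k) F"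
      unfolding intertwiner_def
      by (intro tendsto_add tendsto_diff tendsto_sum tendsto_mult_algebra tendsto_const lim)
    moreover have "intertwiner n p p i k = (if i = k then 1 else 0)"
      using p that by (simp add: intertwiner_def idempotent_matrix_def)
    ultimately show ?thesis by simp
  qed
  then have "\<forall>\<^sub>F s in F.
      (\<forall>x. (\<forall>i<n. (\<Sum>j<n. intertwiner n p (q s) i j * x j) = 0) \<longrightarrow> (\<forall>i<n. x i = 0)) \<and>
      (\<forall>y. \<exists>x. \<forall>i<n. (\<Sum>j<n. intertwiner n p (q s) i j * x j) = y i)"
    by (rule eventually_matrix_regular)
  then show ?thesis
    by eventually_elim (rule matrix_image_bij_betw [OF p q]; blast)
qed


section \<open>Twisted modules\<close>

lemma matrix_apply_hom:
  assumes "\<And>x y. \<psi> (x + y) = \<psi> x + \<psi> y" "\<And>x y. \<psi> (x * y) = \<psi> x * \<psi> y"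
  shows "\<psi> \<circ> matrix_apply n p x = matrix_apply n (\<lambda>i j. \<psi> (p i j)) (\<psi> \<circ> x)"
proof -
  interpret additive \<psi> by standard (rule assms)
  show ?thesis
    by (simp add: fun_eq_iff matrix_apply_def sum zero assms(2))
qed

lemma idempotent_matrix_hom:
  assumes "\<And>x y. \<psi> (x + y) = \<psi> x + \<psi> y" "\<And>x y. \<psi> (x * y) = \<psi> x * \<psi> y"
    and "idempotent_matrix n p"
  shows "idempotent_matrix n (\<lambda>i j. \<psi> (p i j))"
proof -
  interpret additive \<psi> by standard (rule assms)
  show ?thesis
    using assms(3) by (simp add: idempotent_matrix_def flip: assms(2) sum)
qed

lemma rmod_isomorphic_inverse:
  assumes "bij \<theta>" "\<And>s t. \<theta> (s + t) = \<theta> s + \<theta> t" "\<And>s a. \<theta> (act s a) = act' (\<theta> s) a"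
  shows "rmod_isomorphic act' act"
  unfolding rmod_isomorphic_def
proof (intro exI conjI allI)
  show "bij (inv_into UNIV \<theta>)"
    using assms(1) by (rule bij_imp_bij_inv)
  have inv: "\<theta> (inv_into UNIV \<theta> x) = x" for x
    using assms(1) by (simp add: bij_is_surj surj_f_inv_f)
  have eq: "inv_into UNIV \<theta> x = y" if "x = \<theta> y" for x y
    using that assms(1) by (simp add: bij_is_inj)
  show "inv_into UNIV \<theta> (s + t) = inv_into UNIV \<theta> s + inv_into UNIV \<theta> t" "inv_into UNIV \<theta> (act' s a) = act (inv_into UNIV \<theta> s) a" for s t a
    by (auto intro!: eq simp: assms inv)
qed

text \<open>Transported to \<open>E\<close> along \<open>\<phi>\<close>, the map \<open>x \<mapsto> p \<psi>(x)\<close> becomes a bijection \<open>\<theta>\<close> with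
  \<open>\<theta> (s a) = \<theta> (s) \<psi>(a)\<close>, an isomorphism from \<open>E\<close> to the twisted module.\<close>

lemma rmod_isomorphic_twist:
  fixes act :: "'e::ab_group_add \<Rightarrow> 'a::{ring, monoid_mult} \<Rightarrow> 'e"
  assumes bij: "bij \<psi>"
    and add: "\<And>x y. \<psi> (x + y) = \<psi> x + \<psi> y" and mult: "\<And>x y. \<psi> (x * y) = \<psi> x * \<psi> y"
    and p: "idempotent_matrix n p"
    and \<phi>: "bij_betw \<phi> UNIV (matrix_image n p)"
      "\<And>s t. \<phi> (s + t) = (\<lambda>i. \<phi> s i + \<phi> t i)" "\<And>s a. \<phi> (act s a) = (\<lambda>i. \<phi> s i * a)"
    and q: "bij_betw (matrix_apply n p) (matrix_image n (\<lambda>i j. \<psi> (p i j))) (matrix_image n p)"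
  shows "rmod_isomorphic (twist act \<psi>) act"
proof -
  let ?q = "\<lambda>i j. \<psi> (p i j)"
  note hom = matrix_apply_hom [of \<psi>, OF add mult]
  have "bij_betw ((\<circ>) \<psi>) (matrix_image n p) (matrix_image n ?q)"
    unfolding matrix_image_eq_fixed [OF p]
      matrix_image_eq_fixed [OF idempotent_matrix_hom [of \<psi>, OF add mult p]]
  proof (rule bij_betw_imageI)
    show "inj_on ((\<circ>) \<psi>) {x. matrix_apply n p x = x}"
      using bij by (auto intro!: inj_onI simp: fun_eq_iff bij_is_inj inj_eq)
    show "(\<circ>) \<psi> ` {x. matrix_apply n p x = x} = {x. matrix_apply n ?q x = x}"
    proof (intro equalityI subsetI)
      fix y assume y: "y \<in> {x. matrix_apply n ?q x = x}"
      define x where "x = inv_into UNIV \<psi> \<circ> y"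
      have yx: "y = \<psi> \<circ> x"
        using bij by (simp add: x_def fun_eq_iff bij_is_surj surj_f_inv_f)
      have "\<psi> \<circ> matrix_apply n p x = \<psi> \<circ> x"
        using y by (simp add: hom flip: yx)
      then have "matrix_apply n p x = x"
        using bij by (auto simp: fun_eq_iff bij_is_inj inj_eq)
      with yx show "y \<in> (\<circ>) \<psi> ` {x. matrix_apply n p x = x}"
        by blast
    qed (auto simp: hom [symmetric])
  qed
  from bij_betw_trans [OF bij_betw_trans [OF \<phi>(1) this] q]
  have \<Theta>: "bij_betw (\<lambda>s. matrix_apply n p (\<psi> \<circ> \<phi> s)) UNIV (matrix_image n p)"
    by (simp add: o_def)
  define \<theta> where "\<theta> s = inv_into UNIV \<phi> (matrix_apply n p (\<psi> \<circ> \<phi> s))" for s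
  have "bij \<theta>"
    using bij_betw_trans [OF \<Theta> bij_betw_inv_into [OF \<phi>(1)]]
    by (simp add: o_def \<theta>_def [abs_def])
  have \<phi>\<theta>: "\<phi> (\<theta> s) = matrix_apply n p (\<psi> \<circ> \<phi> s)" for s
    unfolding \<theta>_def
    by (rule bij_betw_inv_into_right [OF \<phi>(1) bij_betwE [OF \<Theta>, rule_format]]) simp
  have inj: "s = t" if "\<phi> s = \<phi> t" for s t
    using \<phi>(1) that by (auto simp: bij_betw_def dest: injD)
  show ?thesis
  proof (rule rmod_isomorphic_inverse [OF \<open>bij \<theta>\<close>])
    show "\<theta> (s + t) = \<theta> s + \<theta> t" for s t
    proof (rule inj)
      have "\<psi> \<circ> \<phi> (s + t) = (\<lambda>i. (\<psi> \<circ> \<phi> s) i + (\<psi> \<circ> \<phi> t) i)"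
        by (simp add: \<phi>(2) add fun_eq_iff)
      then show "\<phi> (\<theta> (s + t)) = \<phi> (\<theta> s + \<theta> t)"
        unfolding \<phi>(2) \<phi>\<theta> by (simp only: matrix_apply_add)
    qed
    show "\<theta> (act s a) = twist act \<psi> (\<theta> s) a" for s a
    proof (rule inj)
      have "\<psi> \<circ> \<phi> (act s a) = (\<lambda>i. (\<psi> \<circ> \<phi> s) i * \<psi> a)"
        by (simp add: \<phi>(3) mult fun_eq_iff)
      then show "\<phi> (\<theta> (act s a)) = \<phi> (twist act \<psi> (\<theta> s) a)"
        unfolding twist_def \<phi>(3) \<phi>\<theta> by (simp only: matrix_apply_right_mult)
    qed
  qed
qed


section \<open>The stabilizer of a module\<close>

context smooth_algebra_action
begin

lemma action_aut:
  assumes "g \<in> carrier G"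
  shows "\<mu> g \<in> algebra_aut sc"
  using hom_in_carrier [OF action_hom assms] by (simp add: algebra_aut_group_def)

lemma action_add: "g \<in> carrier G \<Longrightarrow> \<mu> g (x + y) = \<mu> g x + \<mu> g y"
  and action_algebra_mult: "g \<in> carrier G \<Longrightarrow> \<mu> g (x * y) = \<mu> g x * \<mu> g y"
  using action_aut [of g] by (simp_all add: algebra_aut_def)

lemma continuous_action: "g \<in> carrier G \<Longrightarrow> continuous_on UNIV (\<mu> g)"
  and bij_action: "g \<in> carrier G \<Longrightarrow> bij (\<mu> g)"
  using action_aut [of g]
  by (auto simp: algebra_aut_def homeomorphism_def bij_def intro: inj_on_inverseI)

lemma action_mult:
  assumes "g \<in> carrier G" "h \<in> carrier G"
  shows "\<mu> (g \<otimes> h) a = \<mu> g (\<mu> h a)"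
  using hom_mult [OF action_hom assms] by (simp add: algebra_aut_group_def)

lemma action_one: "\<mu> \<one> a = a"
proof -
  have "\<mu> \<one> (\<mu> \<one> a) = \<mu> \<one> a"
    using action_mult [of \<one> \<one> a] by simp
  then show ?thesis
    using bij_action [of \<one>] by (simp add: bij_is_inj inj_eq)
qed

text \<open>Isomorphisms \<open>E\<^sup>g \<rightarrow> E\<close> and \<open>E\<^sup>h \<rightarrow> E\<close> compose to an isomorphism from the twist by \<open>g h\<close> to \<open>E\<close>, since
  the first of them is also an isomorphism from that twist to \<open>E\<^sup>h\<close>.\<close>

lemma subgroup_module_stabilizer: "subgroup (module_stabilizer G \<mu> act) G"
proof
  show "module_stabilizer G \<mu> act \<subseteq> carrier G"
    by (auto simp: module_stabilizer_def)
  show "\<one> \<in> module_stabilizer G \<mu> act"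
    by (auto simp: module_stabilizer_def rmod_isomorphic_def twist_def action_one
        intro!: exI [of _ id])
next
  fix g h assume "g \<in> module_stabilizer G \<mu> act" "h \<in> module_stabilizer G \<mu> act"
  then obtain \<phi> \<rho> where "g \<in> carrier G" "h \<in> carrier G"
    and "bij \<phi>" "\<And>s t. \<phi> (s + t) = \<phi> s + \<phi> t" "\<And>s a. \<phi> (act s (\<mu> g a)) = act (\<phi> s) a"
    and "bij \<rho>" "\<And>s t. \<rho> (s + t) = \<rho> s + \<rho> t" "\<And>s a. \<rho> (act s (\<mu> h a)) = act (\<rho> s) a"
    by (auto simp: module_stabilizer_def rmod_isomorphic_def twist_def)
  then show "g \<otimes> h \<in> module_stabilizer G \<mu> act"
    by (auto simp: module_stabilizer_def rmod_isomorphic_def twist_def action_mult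
        intro!: exI [of _ "\<rho> \<circ> \<phi>"] bij_comp)
next
  fix g assume "g \<in> module_stabilizer G \<mu> act"
  then obtain \<phi> where g: "g \<in> carrier G"
    and \<phi>: "bij \<phi>" "\<And>s t. \<phi> (s + t) = \<phi> s + \<phi> t" "\<And>s a. \<phi> (act s (\<mu> g a)) = act (\<phi> s) a"
    by (auto simp: module_stabilizer_def rmod_isomorphic_def twist_def)
  have "\<mu> g (\<mu> (inv g) a) = a" for a
    using action_mult [of g "inv g" a] g by (simp add: action_one)
  then have "\<phi> (act s a) = twist act (\<mu> (inv g)) (\<phi> s) a" for s a
    using \<phi>(3) [of s "\<mu> (inv g) a"] by (simp add: twist_def)
  with \<phi>(1,2) have "rmod_isomorphic (twist act (\<mu> (inv g))) act"
    by (rule rmod_isomorphic_inverse)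
  with g show "inv g \<in> module_stabilizer G \<mu> act"
    by (simp add: module_stabilizer_def)
qed

lemma tendsto_orbit:
  assumes "h \<in> carrier G"
  shows "((\<lambda>g. \<mu> g a) \<longlongrightarrow> \<mu> h a) (nhdsin T h)"
proof -
  have "continuous_map (prod_topology T euclidean) euclidean (\<lambda>(g, a). \<mu> g a)"
    using action_smooth by (simp add: smooth_map_def)
  moreover have "continuous_map T (prod_topology T euclidean) (\<lambda>g. (g, a))"
    by (simp add: continuous_map_pairedI)
  ultimately have "continuous_map T euclidean ((\<lambda>(g, a). \<mu> g a) \<circ> (\<lambda>g. (g, a)))"
    by (rule continuous_map_compose [rotated])
  then have "continuous_map T euclidean (\<lambda>g. \<mu> g a)"
    by (simp add: o_def)
  then show ?thesis
    using assms
    by (intro topological_tendstoI)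
      (force simp: eventually_nhdsin topspace_eq continuous_map_def)
qed

text \<open>By continuity of the orbit maps and of the automorphism \<open>\<mu> (inv h)\<close>, the matrix
  \<open>\<mu> (inv h \<otimes> g) (p) = \<mu> (inv h) (\<mu> g (p))\<close> tends to \<open>p\<close> as \<open>g\<close> tends to \<open>h\<close>.\<close>

lemma eventually_in_module_stabilizer:
  assumes act: "fg_projective act" and h: "h \<in> carrier G"
  shows "\<forall>\<^sub>F g in nhdsin T h. inv h \<otimes> g \<in> module_stabilizer G \<mu> act"
proof -
  obtain n p \<phi> where p: "idempotent_matrix n p"
    and \<phi>: "bij_betw \<phi> UNIV (matrix_image n p)"
      "\<And>s t. \<phi> (s + t) = (\<lambda>i. \<phi> s i + \<phi> t i)" "\<And>s a. \<phi> (act s a) = (\<lambda>i. \<phi> s i * a)"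
    using act by (auto simp: fg_projective_def)
  let ?\<psi> = "\<lambda>g. \<mu> (inv h \<otimes> g)"
  have "((\<lambda>g. \<mu> (inv h) (\<mu> g a)) \<longlongrightarrow> \<mu> (inv h) (\<mu> h a)) (nhdsin T h)" for a
    using continuous_action [of "inv h"] h
    by (intro isCont_tendsto_compose [OF _ tendsto_orbit])
      (simp_all add: continuous_on_eq_continuous_at)
  moreover have "\<mu> (inv h) (\<mu> h a) = a" for a
    using action_mult [of "inv h" h a] h by (simp add: action_one)
  ultimately have lim: "((\<lambda>g. \<mu> (inv h) (\<mu> g a)) \<longlongrightarrow> a) (nhdsin T h)" for a
    by simp
  have carrier: "\<forall>\<^sub>F g in nhdsin T h. g \<in> carrier G"
    unfolding topspace_eq [symmetric] eventually_nhdsin by blast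
  \<comment> \<open>The default \<open>p\<close> makes \<open>q g\<close> idempotent for every \<open>g\<close>, also off the carrier, where nothing is known
    about \<open>\<mu>\<close>.\<close>
  define q where "q g = (if g \<in> carrier G then \<lambda>i j. ?\<psi> g (p i j) else p)" for g
  have "\<forall>\<^sub>F g in nhdsin T h. bij_betw (matrix_apply n p) (matrix_image n (q g)) (matrix_image n p)"
  proof (rule eventually_matrix_image_bij_betw [OF p])
    show "idempotent_matrix n (q g)" for g
    proof (cases "g \<in> carrier G")
      case True
      then have "inv h \<otimes> g \<in> carrier G"
        using h by simp
      then have "idempotent_matrix n (\<lambda>i j. ?\<psi> g (p i j))"
        by (intro idempotent_matrix_hom [OF _ _ p] action_add action_algebra_mult)
      with True show ?thesis
        by (simp add: q_def)
    qed (simp add: q_def p)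
    have "\<forall>\<^sub>F g in nhdsin T h. \<mu> (inv h) (\<mu> g (p i j)) = q g i j" for i j
      using carrier by eventually_elim (simp add: q_def action_mult h)
    then show "((\<lambda>g. q g i j) \<longlongrightarrow> p i j) (nhdsin T h)" for i j
      by (rule Lim_transform_eventually [OF lim])
  qed
  with carrier show ?thesis
  proof eventually_elim
    case (elim g)
    then have g: "inv h \<otimes> g \<in> carrier G"
      using h by simp
    have "bij_betw (matrix_apply n p) (matrix_image n (\<lambda>i j. ?\<psi> g (p i j))) (matrix_image n p)"
      using elim by (simp add: q_def)
    then have "rmod_isomorphic (twist act (?\<psi> g)) act"
      by (rule rmod_isomorphic_twist [OF bij_action [OF g] action_add [OF g]
            action_algebra_mult [OF g] p \<phi>])
    with g show ?case
      by (simp add: module_stabilizer_def)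
  qed
qed

text \<open>As \<open>inv h \<otimes> g\<close> lies in the subgroup \<open>G\<^sub>E\<close> for \<open>g\<close> near \<open>h\<close>, such \<open>g\<close> and \<open>h\<close> are in the same coset
  of \<open>G\<^sub>E\<close>.\<close>

lemma module_stabilizer_clopen:
  assumes "fg_projective act"
  shows "openin T (module_stabilizer G \<mu> act)"
    and "openin T (carrier G - module_stabilizer G \<mu> act)"
proof -
  let ?S = "module_stabilizer G \<mu> act"
  note sub = subgroup_module_stabilizer [of act]
  have near: "\<exists>U. openin T U \<and> h \<in> U \<and> (\<forall>g\<in>U. g \<in> ?S \<longleftrightarrow> h \<in> ?S)" if h: "h \<in> carrier G" for h
  proof -
    obtain U where U: "openin T U" "h \<in> U" "\<And>g. g \<in> U \<Longrightarrow> inv h \<otimes> g \<in> ?S"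
      using eventually_in_module_stabilizer [OF assms h] h
      by (auto simp: eventually_nhdsin topspace_eq)
    have "g \<in> ?S \<longleftrightarrow> h \<in> ?S" if "g \<in> U" for g
    proof -
      have g: "g \<in> carrier G"
        using openin_subset [OF U(1)] that by (auto simp: topspace_eq)
      have "g = h \<otimes> (inv h \<otimes> g)" "h = g \<otimes> inv (inv h \<otimes> g)"
        using g h by (simp_all add: inv_mult_group flip: m_assoc)
      then show ?thesis
        using U(3) [OF that] subgroup.m_closed [OF sub] subgroup.m_inv_closed [OF sub] by metis
    qed
    with U(1,2) show ?thesis by blast
  qed
  have U_carrier: "U \<subseteq> carrier G" if "openin T U" for U
    using openin_subset [OF that] by (simp add: topspace_eq)
  show "openin T ?S"
  proof (subst openin_subopen, intro ballI)
    fix h assume h: "h \<in> ?S"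
    then have "h \<in> carrier G"
      using subgroup.mem_carrier [OF sub] by blast
    from near [OF this] obtain U where U: "openin T U" "h \<in> U" "\<forall>g\<in>U. g \<in> ?S \<longleftrightarrow> h \<in> ?S"
      by (elim exE conjE)
    have "g \<in> ?S" if "g \<in> U" for g
      using bspec [OF U(3) that] h by (rule iffD2)
    with U(1,2) show "\<exists>U. openin T U \<and> h \<in> U \<and> U \<subseteq> ?S"
      by blast
  qed
  show "openin T (carrier G - ?S)"
  proof (subst openin_subopen, intro ballI)
    fix h assume h: "h \<in> carrier G - ?S"
    then have "h \<in> carrier G"
      by simp
    from near [OF this] obtain U where U: "openin T U" "h \<in> U" "\<forall>g\<in>U. g \<in> ?S \<longleftrightarrow> h \<in> ?S"
      by (elim exE conjE)
    have "g \<in> carrier G - ?S" if "g \<in> U" for g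
      using bspec [OF U(3) that] h U_carrier [OF U(1)] that by blast
    with U(1,2) show "\<exists>U. openin T U \<and> h \<in> U \<and> U \<subseteq> carrier G - ?S"
      by blast
  qed
qed

end

theorem proposition3p1:
  fixes sc :: "'k::real_or_complex \<Rightarrow>
      'a::{real_algebra, monoid_mult, locally_convex_space} \<Rightarrow> 'a"
    and G :: "('g, 'z) monoid_scheme"
    and T :: "'g topology"
    and \<A> :: "('g, 'm::locally_convex_space) chart set"
    and \<mu> :: "'g \<Rightarrow> 'a \<Rightarrow> 'a"
    and act :: "'e::ab_group_add \<Rightarrow> 'a \<Rightarrow> 'e"
  assumes "continuous_inverse_algebra sc"
    and "mackey_complete sc"
    and "lie_group G T \<A>"
    and "smooth_algebra_action sc G T \<A> \<mu>"
    and "right_module act"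
    and "fg_projective act"
  shows "subgroup (module_stabilizer G \<mu> act) G \<and>
    module_stabilizer G \<mu> act = {g \<in> carrier G. \<mu> g \<in> Aut_module sc act} \<and>
    openin T (module_stabilizer G \<mu> act) \<and>
    (connected_space T \<longrightarrow> \<mu> ` carrier G \<subseteq> Aut_module sc act)"
proof -
  interpret smooth_algebra_action sc G T \<A> \<mu> by fact
  let ?S = "module_stabilizer G \<mu> act"
  have eq: "?S = {g \<in> carrier G. \<mu> g \<in> Aut_module sc act}"
    using action_aut by (auto simp: module_stabilizer_def Aut_module_def)
  have "\<mu> ` carrier G \<subseteq> Aut_module sc act" if "connected_space T"
  proof -
    have "closedin T ?S"
      using module_stabilizer_clopen [OF \<open>fg_projective act\<close>]
        subgroup.subset [OF subgroup_module_stabilizer [of act]]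
      by (simp add: closedin_def topspace_eq)
    then have "?S = {} \<or> ?S = carrier G"
      using that module_stabilizer_clopen(1) [OF \<open>fg_projective act\<close>]
      by (auto simp: connected_space_clopen_in topspace_eq)
    moreover have "\<one>\<^bsub>G\<^esub> \<in> ?S"
      by (rule subgroup.one_closed [OF subgroup_module_stabilizer])
    ultimately show ?thesis
      using eq by auto
  qed
  then show ?thesis
    using subgroup_module_stabilizer module_stabilizer_clopen(1) [OF \<open>fg_projective act\<close>] eq
    by blast
qed

end
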